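(* Let $U\subset\mathbb{C}_\tau$ and $\Omega\subset\mathbb{C}^n_z$ be bounded domains and $\varphi\colon U\times\Omega\to\mathbb{R}$ a plurisubharmonic function that is smooth on $\overline{U\times\Omega}$. Let $g\colon U\to\mathbb{R}_{\ge0}$ be non-negative and assume $$\frac{\partial^2\varphi}{\partial\tau\partial\bar\tau}(\tau,z)-\left|\frac{\partial\varphi}{\partial\tau}(\tau,z)\right|^2\geq g(\tau)\quad\text{on }U\times\Omega.$$ Define $\Phi$ by $e^{-\Phi(\tau)}=\int_{z\in\Omega}e^{-\varphi(\tau,z)}$ and $$G(\tau)=g(\tau)+\frac{\left|\int_{z\in\Omega}\frac{\partial\varphi}{\partial\tau}(\tau,z)e^{-\varphi(\tau,z)}\right|^2}{\left(\int_{z\in\Omega}e^{-\varphi(\tau,z)}\right)^2}.$$ Then for every $a\in U$ and every $\varepsilon>0$ there exists $r_\varepsilon\in(0,\delta(a))$ such that for all $r\in(0,r_\varepsilon)$, $L_\Phi(a,r)\leq e^{-\max\{\frac{G(a)-\varepsilon}{2},0\}r^2}$; that is, there exists a holomorphic function $f_r$ on $\Delta(a;r)$ with $f_r(a)=1$ and $$\int_{\Delta(a;r)\times\Omega}|f_r(\tau)|^2e^{-\varphi(\tau,z)}\leq e^{-\max\{\frac{G(a)-\varepsilon}{2},0\}r^2}\,\pi r^2\int_\Omega e^{-\varphi(a,z)}.$$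
   Context: $\Delta(a;r)=\{\tau\in\mathbb{C}\mid|\tau-a|<r\}$; $\delta(a)=\sup\{r>0\mid\Delta(a;r)\subset U\}$. For $0<r<\delta(a)$, $L_\Phi(a,r)=\inf\{\int_{\Delta(a;r)}|f|^2e^{-\Phi}/(\pi r^2e^{-\Phi(a)})\mid f\text{ holomorphic on }\Delta(a;r),\ \int_{\Delta(a;r)}|f|^2e^{-\Phi}<\infty,\ f(a)=1\}$. *)

theory Defs
  imports "HOL-Analysis.Analysis"
begin

definition cscale :: "complex \<Rightarrow> complex \<times> (complex^'n) \<Rightarrow> complex \<times> (complex^'n)" where
  "cscale c p = (c * fst p, \<chi> i. c * (snd p $ i))"

definition dderiv :: "('a::real_normed_vector \<Rightarrow> real) \<Rightarrow> 'a \<Rightarrow> 'a \<Rightarrow> real" where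
  "dderiv f v x = frechet_derivative f (at x) v"

fun iter_dderiv :: "('a::real_normed_vector) list \<Rightarrow> ('a \<Rightarrow> real) \<Rightarrow> 'a \<Rightarrow> real" where
  "iter_dderiv [] f = f"
| "iter_dderiv (v # vs) f = dderiv (iter_dderiv vs f) v"

definition smooth_on :: "'a::real_normed_vector set \<Rightarrow> ('a \<Rightarrow> real) \<Rightarrow> bool" where
  "smooth_on S f \<longleftrightarrow> open S \<and> (\<forall>vs. iter_dderiv vs f differentiable_on S)"

definition smooth_on_closure :: "'a::real_normed_vector set \<Rightarrow> ('a \<Rightarrow> real) \<Rightarrow> bool" where
  "smooth_on_closure S f \<longleftrightarrow>
     (\<exists>V \<psi>. open V \<and> closure S \<subseteq> V \<and> smooth_on V \<psi> \<and> (\<forall>x\<in>S. \<psi> x = f x))"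

definition psh :: "(complex \<times> (complex^'n)) set \<Rightarrow> (complex \<times> (complex^'n) \<Rightarrow> real) \<Rightarrow> bool" where
  "psh D \<phi> \<longleftrightarrow> open D \<and>
     (\<forall>x\<in>D. \<forall>c. \<phi> x < c \<longrightarrow> (\<forall>\<^sub>F y in at x. \<phi> y < c)) \<and>
     (\<forall>a b. (\<forall>\<zeta>. cmod \<zeta> \<le> 1 \<longrightarrow> a + cscale \<zeta> b \<in> D) \<longrightarrow>
        \<phi> a \<le> (1 / (2 * pi)) * integral {0..2*pi} (\<lambda>\<theta>. \<phi> (a + cscale (cis \<theta>) b)))"

definition domain :: "'a::topological_space set \<Rightarrow> bool" where
  "domain S \<longleftrightarrow> open S \<and> connected S \<and> S \<noteq> {}"

definition d_tau :: "(complex \<times> (complex^'n) \<Rightarrow> real) \<Rightarrow> complex \<times> (complex^'n) \<Rightarrow> complex" where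
  "d_tau \<phi> p = (complex_of_real (dderiv \<phi> (1, 0) p) - \<i> * complex_of_real (dderiv \<phi> (\<i>, 0) p)) / 2"

definition dd_tau :: "(complex \<times> (complex^'n) \<Rightarrow> real) \<Rightarrow> complex \<times> (complex^'n) \<Rightarrow> real" where
  "dd_tau \<phi> p = (dderiv (dderiv \<phi> (1, 0)) (1, 0) p + dderiv (dderiv \<phi> (\<i>, 0)) (\<i>, 0) p) / 4"

definition bdist :: "complex set \<Rightarrow> complex \<Rightarrow> real" where
  "bdist U a = Sup {r. r > 0 \<and> ball a r \<subseteq> U}"

end

theory Submission
  imports Defs
begin

text \<open>
  Put \<open>E = \<integral> e\<^sup>-\<^sup>\<phi>\<close> over the fibre at \<open>a\<close>, let \<open>c = - (\<integral> \<phi>\<^sub>\<tau> e\<^sup>-\<^sup>\<phi>) / E\<close>, and take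
  \<open>f(\<tau>) = exp (- c (\<tau> - a))\<close>, which kills the first-order term of \<open>|f|\<^sup>2 e\<^sup>-\<^sup>\<Phi>\<close> at \<open>a\<close>.
  For fixed \<open>z\<close> the function \<open>u = |f|\<^sup>2 e\<^sup>-\<^sup>\<phi>\<close> satisfies
  \<open>\<Delta>u / 4 = u (|c + \<phi>\<^sub>\<tau>|\<^sup>2 - \<phi>\<^sub>\<tau>\<^sub>\<tau>\<^sub>b\<^sub>a\<^sub>r)\<close>. By uniform continuity on a compact set, near \<open>a\<close> this is at most
  its bound at \<open>a\<close> plus a small constant, uniformly in \<open>z\<close>, and that bound integrates over
  \<open>\<Omega>\<close> to \<open>- G(a) E\<close>. A function with \<open>\<Delta>u \<le> -K\<close> on a disc of radius \<open>r\<close> has mean at most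
  \<open>u(a) - K r\<^sup>2 / 8\<close>; integrating this over \<open>z\<close> and using \<open>1 - x \<le> e\<^sup>-\<^sup>x\<close> gives the claim.
  If \<open>G(a) \<le> \<epsilon>\<close>, then \<open>f = 1\<close> works because \<open>e\<^sup>-\<^sup>\<phi>\<close> is superharmonic in \<open>\<tau>\<close>.
\<close>

section \<open>Lebesgue measure and iterated integrals on the complex plane\<close>

text \<open>Both measures give a box the product of its side lengths, and boxes determine Lebesgue
  measure. This carries results on product measures over to \<open>complex\<close>.\<close>

lemma lborel_complex_eq_distr:
  "distr (lborel :: (real \<times> real) measure) borel (\<lambda>p. Complex (fst p) (snd p)) = lborel"
proof (rule lborel_eqI[symmetric])
  let ?T = "\<lambda>p::real \<times> real. Complex (fst p) (snd p)"
  have [measurable]: "?T \<in> borel_measurable borel"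
    by (intro borel_measurable_continuous_onI continuous_intros)
  fix l u :: complex
  assume le: "\<And>b. b \<in> Basis \<Longrightarrow> l \<bullet> b \<le> u \<bullet> b"
  have le': "Re l \<le> Re u" "Im l \<le> Im u"
    using le[of 1] le[of \<i>] by (auto simp: Basis_complex_def)
  have eq: "?T -` box l u = box (Re l) (Re u) \<times> box (Im l) (Im u)"
    by (auto simp: box_def Basis_complex_def)
  have "emeasure (distr lborel borel ?T) (box l u) = emeasure lborel (?T -` box l u)"
    by (subst emeasure_distr) auto
  also have "\<dots> = emeasure (lborel \<Otimes>\<^sub>M lborel) (box (Re l) (Re u) \<times> box (Im l) (Im u))"
    by (simp add: eq lborel_prod)
  also have "\<dots> = ennreal (Re u - Re l) * ennreal (Im u - Im l)"
    using le' by (subst lborel.emeasure_pair_measure_Times) (auto simp: box_real)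
  also have "\<dots> = ennreal (\<Prod>b\<in>Basis. (u - l) \<bullet> b)"
    using le' by (simp add: Basis_complex_def ennreal_mult)
  finally show "emeasure (distr lborel borel ?T) (box l u) = ennreal (\<Prod>b\<in>Basis. (u - l) \<bullet> b)" .
qed simp

text \<open>Fubini for pairs of reals, transported to \<open>complex\<close>. Both orders are
  recorded because integration by parts over a disc starts along x for one component of a vector
  field and along y for the other.\<close>

lemma
  fixes f :: "complex \<Rightarrow> real"
  assumes f: "integrable lborel f"
  shows lborel_integral_complex_Re_inner: "(LINT y|lborel. LINT x|lborel. f (Complex x y)) = (LINT w|lborel. f w)"
    and lborel_integral_complex_Im_inner: "(LINT x|lborel. LINT y|lborel. f (Complex x y)) = (LINT w|lborel. f w)"
proof -
  let ?T = "\<lambda>p::real \<times> real. Complex (fst p) (snd p)"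
  have T: "?T \<in> lborel \<rightarrow>\<^sub>M borel"
    unfolding measurable_lborel2 by (intro borel_measurable_continuous_onI continuous_intros)
  have f': "f \<in> borel_measurable borel"
    using borel_measurable_integrable[OF f] by simp
  have "integrable (distr lborel borel ?T) f"
    using f by (simp only: lborel_complex_eq_distr)
  then have "integrable lborel (\<lambda>p. f (?T p))"
    by (subst (asm) integrable_distr_eq[OF T f'])
  then have int: "integrable (lborel \<Otimes>\<^sub>M lborel) (\<lambda>(x, y). f (Complex x y))"
    by (simp add: lborel_prod case_prod_unfold)
  have "(LINT w|lborel. f w) = (LINT p|lborel. f (?T p))"
    by (subst lborel_complex_eq_distr[symmetric], rule integral_distr[OF T f'])
  also have "\<dots> = (LINT p|(lborel \<Otimes>\<^sub>M lborel). (\<lambda>(x, y). f (Complex x y)) p)"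
    by (simp add: lborel_prod case_prod_unfold)
  finally have eq: "(LINT w|lborel. f w) = (LINT p|(lborel \<Otimes>\<^sub>M lborel). (\<lambda>(x, y). f (Complex x y)) p)" .
  show "(LINT y|lborel. LINT x|lborel. f (Complex x y)) = (LINT w|lborel. f w)"
    unfolding eq by (rule lborel_pair.integral_snd[OF int])
  show "(LINT x|lborel. LINT y|lborel. f (Complex x y)) = (LINT w|lborel. f w)"
    unfolding eq by (rule lborel_pair.integral_fst[OF int])
qed

section \<open>Integration by parts over a disc and the mean value estimate\<close>

text \<open>The integrand is the derivative of \<open>(s\<^sup>2 - x\<^sup>2) * h x\<close>, which
  vanishes at both endpoints.\<close>

lemma integral_vanishing_weight_by_parts:
  fixes h h' :: "real \<Rightarrow> real"
  assumes s: "0 \<le> s"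
    and h: "continuous_on {-s..s} h"
    and h': "continuous_on {-s..s} h'"
    and deriv: "\<And>x. -s < x \<Longrightarrow> x < s \<Longrightarrow> (h has_real_derivative h' x) (at x)"
  shows "(LINT x:{-s..s}|lborel. (s\<^sup>2 - x\<^sup>2) * h' x - 2 * x * h x) = 0"
proof -
  let ?g = "\<lambda>x. (s\<^sup>2 - x\<^sup>2) * h' x - 2 * x * h x"
  have "(?g has_integral (s\<^sup>2 - s\<^sup>2) * h s - (s\<^sup>2 - (-s)\<^sup>2) * h (-s)) {-s..s}"
  proof (rule fundamental_theorem_of_calculus_interior)
    show "continuous_on {-s..s} (\<lambda>x. (s\<^sup>2 - x\<^sup>2) * h x)"
      by (intro continuous_intros h)
    fix x assume "x \<in> {-s<..<s}"
    then have "(h has_real_derivative h' x) (at x)" using deriv by auto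
    then have "((\<lambda>x. (s\<^sup>2 - x\<^sup>2) * h x) has_real_derivative ?g x) (at x)"
      by (auto intro!: derivative_eq_intros)
    then show "((\<lambda>x. (s\<^sup>2 - x\<^sup>2) * h x) has_vector_derivative ?g x) (at x)"
      by (simp add: has_real_derivative_iff_has_vector_derivative)
  qed (use s in simp)
  then have "integral {-s..s} ?g = 0" by (simp add: integral_unique)
  moreover have "set_integrable lborel {-s..s} ?g"
    unfolding set_integrable_def
    by (intro borel_integrable_compact continuous_intros h h') auto
  ultimately show ?thesis
    by (simp add: set_borel_integral_eq_integral(2))
qed

lemma Complex_mem_cball_0_iff:
  assumes "0 \<le> r"
  shows "Complex x y \<in> cball 0 r \<longleftrightarrow> x\<^sup>2 + y\<^sup>2 \<le> r\<^sup>2"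
  using assms by (simp add: cmod_def real_sqrt_le_iff' real_le_lsqrt sqrt_le_D)

lemma square_le_diff_iff:
  fixes x y r :: real
  assumes "y\<^sup>2 \<le> r\<^sup>2"
  shows "x\<^sup>2 + y\<^sup>2 \<le> r\<^sup>2 \<longleftrightarrow> x \<in> {- sqrt (r\<^sup>2 - y\<^sup>2)..sqrt (r\<^sup>2 - y\<^sup>2)}"
proof -
  have "x\<^sup>2 + y\<^sup>2 \<le> r\<^sup>2 \<longleftrightarrow> sqrt (x\<^sup>2) \<le> sqrt (r\<^sup>2 - y\<^sup>2)"
    by (subst real_sqrt_le_iff) auto
  then show ?thesis by (auto simp: abs_le_iff)
qed

text \<open>A non-empty slice is the interval \<open>{-s..s}\<close> with
  \<open>s\<^sup>2 = r\<^sup>2 - y\<^sup>2\<close>. On it the radial weight is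
  \<open>s\<^sup>2 - x\<^sup>2\<close>, which vanishes at the ends of the slice.\<close>

lemma integral_disc_slice_by_parts:
  fixes h h' :: "real \<Rightarrow> real"
  assumes h: "continuous_on {x. x\<^sup>2 + y\<^sup>2 \<le> r\<^sup>2} h"
    and h': "continuous_on {x. x\<^sup>2 + y\<^sup>2 \<le> r\<^sup>2} h'"
    and deriv: "\<And>x. x\<^sup>2 + y\<^sup>2 < r\<^sup>2 \<Longrightarrow> (h has_real_derivative h' x) (at x)"
  shows "(LINT x:{x. x\<^sup>2 + y\<^sup>2 \<le> r\<^sup>2}|lborel. (r\<^sup>2 - (x\<^sup>2 + y\<^sup>2)) * h' x - 2 * x * h x) = 0"
proof (cases "y\<^sup>2 \<le> r\<^sup>2")
  case False
  then have "{x. x\<^sup>2 + y\<^sup>2 \<le> r\<^sup>2} = {}"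
    by (auto simp: not_le) (smt (verit) zero_le_power2)
  then show ?thesis by (simp add: set_lebesgue_integral_def)
next
  case True
  define s where "s = sqrt (r\<^sup>2 - y\<^sup>2)"
  have s: "0 \<le> s" "s\<^sup>2 = r\<^sup>2 - y\<^sup>2" using True by (auto simp: s_def)
  have S: "{x. x\<^sup>2 + y\<^sup>2 \<le> r\<^sup>2} = {-s..s}"
    using square_le_diff_iff[OF True] unfolding s_def by blast
  have "(LINT x:{-s..s}|lborel. (s\<^sup>2 - x\<^sup>2) * h' x - 2 * x * h x) = 0"
  proof (rule integral_vanishing_weight_by_parts)
    fix x assume "-s < x" "x < s"
    then have "x\<^sup>2 < s\<^sup>2" by (intro abs_square_less_1[THEN iffD1] power2_strict_mono) auto
    then show "(h has_real_derivative h' x) (at x)" using s deriv by simp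
  qed (use s h h' S in auto)
  then show ?thesis
    unfolding S s(2) by (simp add: algebra_simps)
qed

text \<open>This is the divergence theorem for the field (p, q) multiplied by
  \<open>r\<^sup>2 - (cmod w)\<^sup>2\<close>. The product vanishes on the circle, so there is no
  boundary term. Slicing each component along its own direction reduces the claim to one
  variable.\<close>

lemma integral_disc_by_parts:
  fixes p p1 q q2 :: "complex \<Rightarrow> real"
  assumes r: "0 \<le> r"
    and cont: "continuous_on (cball 0 r) p" "continuous_on (cball 0 r) p1"
      "continuous_on (cball 0 r) q" "continuous_on (cball 0 r) q2"
    and p: "\<And>x y. Complex x y \<in> ball 0 r \<Longrightarrow>
      ((\<lambda>x. p (Complex x y)) has_real_derivative p1 (Complex x y)) (at x)"
    and q: "\<And>x y. Complex x y \<in> ball 0 r \<Longrightarrow>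
      ((\<lambda>y. q (Complex x y)) has_real_derivative q2 (Complex x y)) (at y)"
  shows "(LINT w:cball 0 r|lborel. (r\<^sup>2 - (cmod w)\<^sup>2) * (p1 w + q2 w)) =
    (LINT w:cball 0 r|lborel. 2 * (Re w * p w + Im w * q w))"
proof -
  define P where "P w = (r\<^sup>2 - (cmod w)\<^sup>2) * p1 w - 2 * Re w * p w" for w
  define Q where "Q w = (r\<^sup>2 - (cmod w)\<^sup>2) * q2 w - 2 * Im w * q w" for w
  have ball: "Complex x y \<in> ball 0 r" if "x\<^sup>2 + y\<^sup>2 < r\<^sup>2" for x y
    using that r by (simp add: cmod_def) (metis real_sqrt_less_iff real_sqrt_unique)
  have mem: "Complex x y \<in> cball 0 r \<longleftrightarrow> x\<^sup>2 + y\<^sup>2 \<le> r\<^sup>2" for x y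
    by (rule Complex_mem_cball_0_iff[OF r])
  \<comment> \<open>The second form interchanges the coordinates, so that the same slice lemma
    serves vertical lines.\<close>
  have ind: "indicator (cball 0 r) (Complex x y) = (indicator {x. x\<^sup>2 + y\<^sup>2 \<le> r\<^sup>2} x :: real)"
    "indicator (cball 0 r) (Complex x y) = (indicator {y. y\<^sup>2 + x\<^sup>2 \<le> r\<^sup>2} y :: real)" for x y
    using mem by (auto simp: indicator_def add.commute)
  have int: "integrable lborel (\<lambda>w. indicator (cball 0 r) w *\<^sub>R P w)"
    "integrable lborel (\<lambda>w. indicator (cball 0 r) w *\<^sub>R Q w)"
    unfolding P_def Q_def by (intro borel_integrable_compact continuous_intros cont compact_cball)+
  have cx: "continuous_on {x. x\<^sup>2 + y\<^sup>2 \<le> r\<^sup>2} (\<lambda>x. f (Complex x y))"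
    and cy: "continuous_on {x. x\<^sup>2 + y\<^sup>2 \<le> r\<^sup>2} (\<lambda>x. f (Complex y x))"
    if "continuous_on (cball 0 r) f" for f :: "complex \<Rightarrow> real" and y
    by (rule continuous_on_compose2[OF that]; auto intro!: continuous_intros simp: mem add.commute
          simp del: mem_cball mem_cball_0)+
  have "(LINT x|lborel. indicator (cball 0 r) (Complex x y) *\<^sub>R P (Complex x y)) = 0" for y
    using integral_disc_slice_by_parts[OF cx[OF cont(1)] cx[OF cont(2)] p[OF ball], of y]
    by (simp add: ind(1) P_def set_lebesgue_integral_def cmod_power2)
  then have 1: "(LINT w:cball 0 r|lborel. P w) = 0"
    unfolding set_lebesgue_integral_def
    by (subst lborel_integral_complex_Re_inner[OF int(1), symmetric]) simp
  have "(LINT y|lborel. indicator (cball 0 r) (Complex x y) *\<^sub>R Q (Complex x y)) = 0" for x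
    using integral_disc_slice_by_parts[OF cy[OF cont(3)] cy[OF cont(4)] q[OF ball], of x]
    by (simp add: ind(2) Q_def set_lebesgue_integral_def cmod_power2 add.commute)
  then have 2: "(LINT w:cball 0 r|lborel. Q w) = 0"
    unfolding set_lebesgue_integral_def
    by (subst lborel_integral_complex_Im_inner[OF int(2), symmetric]) simp
  have "(LINT w:cball 0 r|lborel. P w + Q w) = 0"
    using int 1 2 by (subst set_integral_add) (auto simp: set_integrable_def)
  moreover have "(LINT w:cball 0 r|lborel. P w + Q w) =
    (LINT w:cball 0 r|lborel. (r\<^sup>2 - (cmod w)\<^sup>2) * (p1 w + q2 w) - 2 * (Re w * p w + Im w * q w))"
    by (simp add: P_def Q_def algebra_simps)
  moreover have "\<dots> = (LINT w:cball 0 r|lborel. (r\<^sup>2 - (cmod w)\<^sup>2) * (p1 w + q2 w)) -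
    (LINT w:cball 0 r|lborel. 2 * (Re w * p w + Im w * q w))"
    by (intro set_integral_diff; unfold set_integrable_def;
        intro borel_integrable_compact continuous_intros cont compact_cball)
  ultimately show ?thesis by simp
qed

text \<open>For the field w, whose divergence is 2, integration by parts says that the weight and
  \<open>(cmod w)\<^sup>2\<close> have equal integrals over the disc. Their sum is the constant r^2,
  with integral pi r^4, and each takes half of it.\<close>

lemma integral_disc_radial_weight:
  assumes r: "0 \<le> r"
  shows "(LINT w:cball 0 r|lborel. r\<^sup>2 - (cmod w)\<^sup>2) = pi * r ^ 4 / 2"
proof -
  let ?A = "LINT w:cball 0 r|lborel. r\<^sup>2 - (cmod w)\<^sup>2"
  let ?B = "LINT w:cball 0 r|lborel. (cmod w)\<^sup>2"
  have int: "set_integrable lborel (cball 0 r) (\<lambda>w::complex. r\<^sup>2 - (cmod w)\<^sup>2)"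
    "set_integrable lborel (cball 0 r) (\<lambda>w::complex. (cmod w)\<^sup>2)"
    unfolding set_integrable_def by (intro borel_integrable_compact continuous_intros compact_cball)+
  have "(LINT w:cball 0 r|lborel. (r\<^sup>2 - (cmod w)\<^sup>2) * (1 + 1)) =
      (LINT w:cball 0 r|lborel. 2 * (Re w * Re w + Im w * Im w))"
    by (rule integral_disc_by_parts[OF r]) (auto intro!: continuous_intros derivative_eq_intros)
  also have "\<dots> = 2 * ?B"
    unfolding set_integral_mult_right[symmetric] by (simp only: cmod_power2, simp only: power2_eq_square)
  finally have "?A = ?B"
    unfolding set_integral_mult_left by (metis mult.commute mult_left_cancel one_add_one zero_neq_numeral)
  moreover have "?A + ?B = (LINT w:cball (0::complex) r|lborel. r\<^sup>2)"
    by (subst set_integral_add(2)[symmetric, OF int]) simp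
  moreover have "\<dots> = pi * r\<^sup>2 * r\<^sup>2"
    using r by (simp add: set_lebesgue_integral_def content_cball unit_ball_vol_2)
  moreover have "pi * r\<^sup>2 * r\<^sup>2 = pi * r ^ 4"
    by (simp add: power2_eq_square power4_eq_xxxx)
  ultimately show ?thesis by linarith
qed

text \<open>
  The mean is controlled by writing \<open>u(a + w) - u(a)\<close> as the integral of \<open>w \<bullet> \<nabla>u(a + t w)\<close> over
  \<open>t \<in> [0, 1]\<close>. As \<open>2 w = - \<nabla>(r\<^sup>2 - |w|\<^sup>2)\<close>, integration by parts over the disc then turns the
  gradient into the Laplacian against a non-negative weight, without polar coordinates.
\<close>

lemma integral_disc_le_of_laplacian_le:
  fixes u ux uy :: "complex \<Rightarrow> real" and ux' uy' :: "complex \<Rightarrow> complex \<Rightarrow> real"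
  assumes r: "0 \<le> r"
    and u: "\<And>w. w \<in> cball a r \<Longrightarrow> (u has_derivative (\<lambda>h. ux w * Re h + uy w * Im h)) (at w)"
    and ux: "\<And>w. w \<in> cball a r \<Longrightarrow> (ux has_derivative ux' w) (at w)"
    and uy: "\<And>w. w \<in> cball a r \<Longrightarrow> (uy has_derivative uy' w) (at w)"
    and uxx: "continuous_on (cball a r) (\<lambda>w. ux' w 1)"
    and uyy: "continuous_on (cball a r) (\<lambda>w. uy' w \<i>)"
    and lap: "\<And>w. w \<in> cball a r \<Longrightarrow> ux' w 1 + uy' w \<i> \<le> - K"
  shows "(LINT w:cball a r|lborel. u w) \<le> pi * r\<^sup>2 * (u a - K * r\<^sup>2 / 8)"
proof -
  let ?B = "cball (0::complex) r"
  define \<gamma> where "\<gamma> t w = a + complex_of_real t * w" for t w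
  \<comment> \<open>\<open>D t w\<close> is the derivative of \<open>u (\<gamma> t w)\<close> in t,
    that is, the gradient of u at \<open>\<gamma> t w\<close> paired with w.\<close>
  define D where "D t w = Re w * ux (\<gamma> t w) + Im w * uy (\<gamma> t w)" for t w
  have \<gamma>: "\<gamma> t w \<in> cball a r" if "t \<in> {0..1}" "w \<in> ?B" for t w
  proof -
    have "\<bar>t\<bar> * cmod w \<le> 1 * r" using that by (intro mult_mono) auto
    then show ?thesis by (simp add: \<gamma>_def dist_norm norm_mult)
  qed
  have cu: "continuous_on (cball a r) u" "continuous_on (cball a r) ux" "continuous_on (cball a r) uy"
    using u ux uy by (auto intro!: continuous_at_imp_continuous_on has_derivative_continuous)
  have c\<gamma>: "continuous_on ?B (\<lambda>w. f (\<gamma> t w))"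
    if "continuous_on (cball a r) f" "t \<in> {0..1}" for f :: "complex \<Rightarrow> real" and t
    by (rule continuous_on_compose2[OF that(1)]) (use \<gamma>[OF that(2)] in \<open>auto simp: \<gamma>_def intro!: continuous_intros\<close>)
  have c\<gamma>2: "continuous_on ({0..1} \<times> ?B) (\<lambda>p. f (\<gamma> (fst p) (snd p)))"
    if "continuous_on (cball a r) f" for f :: "complex \<Rightarrow> real"
    by (rule continuous_on_compose2[OF that]) (use \<gamma> in \<open>auto simp: \<gamma>_def intro!: continuous_intros\<close>)
  \<comment> \<open>Integration by parts applies to the gradient composed with
    \<open>\<gamma> t\<close>. The chain rule contributes a factor t to its divergence, and the
    weight has integral pi r^4 / 2. Since the parts formula computes twice the integral of
    \<open>D t w\<close>, the constant is 1/4.\<close>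
  have slice: "(LINT w:?B|lborel. D t w) \<le> t * (- K * pi * r ^ 4 / 4)" if t: "t \<in> {0..1}" for t
  proof -
    define L where "L w = ux' (\<gamma> t w) 1 + uy' (\<gamma> t w) \<i>" for w
    have lin: "ux' w (complex_of_real s * h) = s * ux' w h" "uy' w (complex_of_real s * h) = s * uy' w h"
      if "w \<in> cball a r" for w s h
      using linear_scale[OF has_derivative_linear[OF ux[OF that]], of s h]
        linear_scale[OF has_derivative_linear[OF uy[OF that]], of s h]
      by (simp_all add: scaleR_conv_of_real)
    have dx: "((\<lambda>x. ux (\<gamma> t (Complex x y))) has_real_derivative t * ux' (\<gamma> t (Complex x y)) 1) (at x)"
      and dy: "((\<lambda>y. uy (\<gamma> t (Complex x y))) has_real_derivative t * uy' (\<gamma> t (Complex x y)) \<i>) (at y)"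
      if "Complex x y \<in> ball 0 r" for x y
    proof -
      have m: "\<gamma> t (Complex x y) \<in> cball a r" using that by (intro \<gamma>[OF t]) auto
      have 1: "((\<lambda>x. \<gamma> t (Complex x y)) has_derivative (\<lambda>h. complex_of_real (h * t) * 1)) (at x)"
        "((\<lambda>y. \<gamma> t (Complex x y)) has_derivative (\<lambda>h. complex_of_real (h * t) * \<i>)) (at y)"
        unfolding \<gamma>_def Complex_eq by (auto intro!: derivative_eq_intros simp: algebra_simps)
      show "((\<lambda>x. ux (\<gamma> t (Complex x y))) has_real_derivative t * ux' (\<gamma> t (Complex x y)) 1) (at x)"
        using has_derivative_compose[OF 1(1) ux[OF m]]
        unfolding has_field_derivative_def lin[OF m] by (simp add: mult_ac mult_commute_abs)
      show "((\<lambda>y. uy (\<gamma> t (Complex x y))) has_real_derivative t * uy' (\<gamma> t (Complex x y)) \<i>) (at y)"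
        using has_derivative_compose[OF 1(2) uy[OF m]]
        unfolding has_field_derivative_def lin[OF m] by (simp add: mult_ac mult_commute_abs)
    qed
    have cL: "continuous_on ?B L"
      unfolding L_def by (intro continuous_intros c\<gamma>[OF uxx t] c\<gamma>[OF uyy t])
    have "2 * (LINT w:?B|lborel. D t w) = (LINT w:?B|lborel. 2 * (Re w * ux (\<gamma> t w) + Im w * uy (\<gamma> t w)))"
      by (simp only: D_def set_integral_mult_right)
    also have "\<dots> = (LINT w:?B|lborel. (r\<^sup>2 - (cmod w)\<^sup>2) * (t * ux' (\<gamma> t w) 1 + t * uy' (\<gamma> t w) \<i>))"
      by (rule integral_disc_by_parts[symmetric, OF r])
        (intro continuous_intros c\<gamma> cu t uxx uyy dx dy; assumption)+
    also have "\<dots> \<le> (LINT w:?B|lborel. (r\<^sup>2 - (cmod w)\<^sup>2) * (- K * t))"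
    proof (rule set_integral_mono)
      fix w assume w: "w \<in> ?B"
      have "t * L w \<le> t * (-K)"
        using t lap[OF \<gamma>[OF t w]] unfolding L_def by (intro mult_left_mono) auto
      moreover have "(cmod w)\<^sup>2 \<le> r\<^sup>2" using w by (intro power_mono) auto
      ultimately show "(r\<^sup>2 - (cmod w)\<^sup>2) * (t * ux' (\<gamma> t w) 1 + t * uy' (\<gamma> t w) \<i>)
          \<le> (r\<^sup>2 - (cmod w)\<^sup>2) * (- K * t)"
        by (intro mult_left_mono) (auto simp: L_def algebra_simps)
    qed (unfold set_integrable_def, (intro borel_integrable_compact continuous_intros compact_cball c\<gamma> uxx uyy t)+)
    also have "\<dots> = pi * r ^ 4 / 2 * (- K * t)"
      by (simp only: set_integral_mult_left integral_disc_radial_weight[OF r])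
    finally show ?thesis by (simp add: algebra_simps)
  qed
  have ftc: "(LINT t:{0..1}|lborel. D t w) = u (\<gamma> 1 w) - u a" if w: "w \<in> ?B" for w
  proof -
    have d: "((\<lambda>t. u (\<gamma> t w)) has_real_derivative D t w) (at t)" if "t \<in> {0..1}" for t
    proof -
      have "((\<lambda>t. \<gamma> t w) has_derivative (\<lambda>h. complex_of_real h * w)) (at t)"
        unfolding \<gamma>_def by (auto intro!: derivative_eq_intros)
      from has_derivative_compose[OF this u[OF \<gamma>[OF that w]]]
      show ?thesis unfolding has_field_derivative_def D_def by (rule has_derivative_eq_rhs) (auto simp: fun_eq_iff algebra_simps)
    qed
    have "continuous_on {0..1} (\<lambda>t. D t w)"
    proof -
      have "continuous_on {0..1} (\<lambda>t. f (\<gamma> t w))" if "continuous_on (cball a r) f" for f :: "complex \<Rightarrow> real"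
        by (rule continuous_on_compose2[OF that]) (use \<gamma>[OF _ w] in \<open>auto simp: \<gamma>_def intro!: continuous_intros\<close>)
      from this[OF cu(2)] this[OF cu(3)] show ?thesis unfolding D_def by (intro continuous_intros)
    qed
    then have int: "set_integrable lborel {0..1} (\<lambda>t. D t w)"
      unfolding set_integrable_def by (intro borel_integrable_compact) auto
    have "((\<lambda>t. D t w) has_integral u (\<gamma> 1 w) - u (\<gamma> 0 w)) {0..1}"
      using d by (intro fundamental_theorem_of_calculus)
        (auto simp: has_real_derivative_iff_has_vector_derivative[symmetric] intro: has_field_derivative_at_within)
    then show ?thesis
      using set_borel_integral_eq_integral(2)[OF int] by (simp add: integral_unique \<gamma>_def)
  qed
  \<comment> \<open>Cutting off by indicators gives a function on the full product, where Fubini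
    lets w be integrated first, so that \<open>slice\<close> applies for each fixed t.\<close>
  define F where "F t w = indicator {0..1} t *\<^sub>R (indicator ?B w *\<^sub>R D t w)" for t w
  have "integrable lborel (\<lambda>p. indicator ({0..1} \<times> ?B) p *\<^sub>R (\<lambda>p. D (fst p) (snd p)) p)"
    unfolding D_def by (intro borel_integrable_compact continuous_intros c\<gamma>2 cu compact_Times compact_cball) auto
  then have intF: "integrable (lborel \<Otimes>\<^sub>M lborel) (case_prod F)"
    by (simp add: lborel_prod case_prod_unfold F_def indicator_times mult_ac)
  have "(LINT w:?B|lborel. u (\<gamma> 1 w) - u a) = (LINT w:?B|lborel. LINT t:{0..1}|lborel. D t w)"
    by (rule set_lebesgue_integral_cong) (auto simp: ftc)
  also have "\<dots> = (LINT w|lborel. LINT t|lborel. F t w)"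
    unfolding set_lebesgue_integral_def F_def
    by (intro Bochner_Integration.integral_cong refl) (simp split: split_indicator)
  also have "\<dots> = (LINT t|lborel. LINT w|lborel. F t w)"
    by (rule lborel_pair.Fubini_integral[OF intF])
  also have "\<dots> \<le> (LINT t|lborel. indicator {0..1} t *\<^sub>R (t * (- K * pi * r ^ 4 / 4)))"
  proof (rule integral_mono)
    show "integrable lborel (\<lambda>t. LINT w|lborel. F t w)"
      using lborel_pair.integrable_fst[OF intF] by simp
    show "integrable lborel (\<lambda>t::real. indicator {0..1} t *\<^sub>R (t * (- K * pi * r ^ 4 / 4)))"
      by (intro borel_integrable_compact continuous_intros) auto
    show "(LINT w|lborel. F t w) \<le> indicator {0..1} t *\<^sub>R (t * (- K * pi * r ^ 4 / 4))" for t
      using slice[of t] unfolding F_def set_lebesgue_integral_def by (simp split: split_indicator)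
  qed
  also have "\<dots> = (LINT t:{0..1}|lborel. t) * (- K * pi * r ^ 4 / 4)"
    by (simp only: set_lebesgue_integral_def[symmetric] set_integral_mult_left)
  \<comment> \<open>This factor 1/2 turns the 1/4 of \<open>slice\<close> into the final
    1/8.\<close>
  also have "(LINT t:{0..1}|lborel. t) = (1/2::real)"
  proof -
    have "set_integrable lborel {0..1} (\<lambda>t::real. t)"
      unfolding set_integrable_def by (intro borel_integrable_compact continuous_intros) auto
    from set_borel_integral_eq_integral(2)[OF this] show ?thesis
      using ident_has_integral[of 0 "1::real"] by (simp add: integral_unique)
  qed
  finally have main: "(LINT w:?B|lborel. u (\<gamma> 1 w) - u a) \<le> - K * pi * r ^ 4 / 8" by simp
  have meas: "(\<lambda>w. indicator (cball a r) w *\<^sub>R u w) \<in> borel_measurable borel"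
    by (intro borel_measurable_continuous_on_indicator cu) auto
  \<comment> \<open>Translation invariance moves the centre of the disc to 0;
    \<open>\<gamma> 1 w\<close> is \<open>a + w\<close>.\<close>
  have "(LINT w:cball a r|lborel. u w) = (LINT w|distr lborel borel ((+) a). indicator (cball a r) w *\<^sub>R u w)"
    by (simp add: set_lebesgue_integral_def lborel_distr_plus)
  also have "\<dots> = (LINT w|lborel. indicator (cball a r) (a + w) *\<^sub>R u (a + w))"
    by (rule integral_distr) (use meas in auto)
  also have "\<dots> = (LINT w:?B|lborel. u (\<gamma> 1 w))"
    unfolding set_lebesgue_integral_def
    by (intro Bochner_Integration.integral_cong) (auto simp: \<gamma>_def indicator_def dist_norm)
  also have "\<dots> = (LINT w:?B|lborel. (u (\<gamma> 1 w) - u a) + u a)" by simp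
  also have "\<dots> = (LINT w:?B|lborel. u (\<gamma> 1 w) - u a) + (LINT w:?B|lborel. u a)"
    by (intro set_integral_add; unfold set_integrable_def;
        intro borel_integrable_compact continuous_intros c\<gamma> cu compact_cball) auto
  also have "(LINT w:?B|lborel. u a) = pi * r\<^sup>2 * u a"
    using r by (simp add: set_lebesgue_integral_def content_cball unit_ball_vol_2)
  finally show ?thesis using main by (simp add: algebra_simps power2_eq_square power4_eq_xxxx)
qed

section \<open>Smooth extensions, derivatives in \<tau>, and the estimate for fixed z\<close>

lemma smooth_on_differentiable_at:
  assumes "smooth_on V \<psi>" "x \<in> V"
  shows "iter_dderiv vs \<psi> differentiable at x"
  using assms unfolding smooth_on_def by (metis differentiable_on_eq_differentiable_at)

lemma smooth_on_continuous_on: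
  assumes "smooth_on V \<psi>"
  shows "continuous_on V (iter_dderiv vs \<psi>)"
  using assms unfolding smooth_on_def by (blast intro: differentiable_imp_continuous_on)

text \<open>A derivative at a point of an open set depends only on the values in that set, so
  equality passes from each order to the next. In the theorem this replaces derivatives of \<phi> by
  those of its extension, which are continuous up to the closure.\<close>

lemma iter_dderiv_cong_open:
  assumes "smooth_on V \<psi>" "open S" "S \<subseteq> V" "\<And>x. x \<in> S \<Longrightarrow> \<psi> x = \<phi> x" "x \<in> S"
  shows "iter_dderiv vs \<phi> x = iter_dderiv vs \<psi> x"
  using assms(5)
proof (induction vs arbitrary: x)
  case Nil
  then show ?case using assms(4) by simp
next
  case (Cons v vs)
  have "frechet_derivative (iter_dderiv vs \<psi>) (at x) = frechet_derivative (iter_dderiv vs \<phi>) (at x)"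
    using smooth_on_differentiable_at[OF assms(1)] Cons assms(2,3)
    by (intro frechet_derivative_transform_within_open[where X = S]) auto
  then show ?case by (simp add: dderiv_def)
qed

text \<open>The full derivative is real linear, and h is \<open>Re h\<close> times 1 plus
  \<open>Im h\<close> times \<open>\<i>\<close>. The result has the gradient form that the disc
  estimate expects.\<close>

lemma has_derivative_complex_slice:
  fixes f :: "complex \<times> 'b::real_normed_vector \<Rightarrow> real"
  assumes "f differentiable at (\<tau>, z)"
  shows "((\<lambda>\<tau>. f (\<tau>, z)) has_derivative
    (\<lambda>h. dderiv f (1, 0) (\<tau>, z) * Re h + dderiv f (\<i>, 0) (\<tau>, z) * Im h)) (at \<tau>)"
proof -
  let ?D = "frechet_derivative f (at (\<tau>, z))"
  have D: "(f has_derivative ?D) (at (\<tau>, z))"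
    using assms by (simp add: frechet_derivative_works)
  have lin: "linear ?D" by (rule has_derivative_linear[OF D])
  have "((\<lambda>\<tau>. (\<tau>, z)) has_derivative (\<lambda>h. (h, 0))) (at \<tau>)"
    by (auto intro!: derivative_eq_intros)
  from has_derivative_compose[OF this D]
  have "((\<lambda>\<tau>. f (\<tau>, z)) has_derivative (\<lambda>h. ?D (h, 0))) (at \<tau>)" .
  moreover have "?D (h, 0) = dderiv f (1, 0) (\<tau>, z) * Re h + dderiv f (\<i>, 0) (\<tau>, z) * Im h" for h
  proof -
    have "(h, 0) = Re h *\<^sub>R (1, 0) + Im h *\<^sub>R (\<i>, 0::'b)"
      by (simp add: complex_eq_iff)
    then show ?thesis
      by (simp only: linear_add[OF lin] linear_scale[OF lin] dderiv_def) simp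
  qed
  ultimately show ?thesis by simp
qed

text \<open>The integrand is \<open>|f|\<^sup>2\<close> times \<open>exp (- \<psi>)\<close> for f =
  \<open>exp (- c * (\<tau> - a))\<close>. The disc estimate applies with
  \<open>K = 4 * \<kappa>\<close>, because \<open>dd_tau\<close> is a quarter of the Laplacian;
  hence K r^2 / 8 becomes \<kappa> r^2 / 2.\<close>

lemma integral_disc_twisted_exp_le:
  fixes \<psi> :: "complex \<times> (complex^'n) \<Rightarrow> real"
  assumes smooth: "smooth_on V \<psi>" and r: "0 \<le> r" and V: "cball a r \<times> {z} \<subseteq> V"
    and lap: "\<And>\<tau>. \<tau> \<in> cball a r \<Longrightarrow> exp (- (2 * Re (c * (\<tau> - a)) + \<psi> (\<tau>, z))) *
      ((cmod (c + d_tau \<psi> (\<tau>, z)))\<^sup>2 - dd_tau \<psi> (\<tau>, z)) \<le> - \<kappa>"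
  shows "(LINT \<tau>:cball a r|lborel. exp (- (2 * Re (c * (\<tau> - a)) + \<psi> (\<tau>, z))))
    \<le> pi * r\<^sup>2 * (exp (- \<psi> (a, z)) - \<kappa> * r\<^sup>2 / 2)"
proof -
  let ?\<psi>1 = "dderiv \<psi> (1, 0)" and ?\<psi>2 = "dderiv \<psi> (\<i>, 0)"
  define v where "v \<tau> = 2 * Re (c * (\<tau> - a)) + \<psi> (\<tau>, z)" for \<tau>
  define vx where "vx \<tau> = 2 * Re c + ?\<psi>1 (\<tau>, z)" for \<tau>
  \<comment> \<open>The sign comes from the derivative of \<open>Re (c * \<tau>)\<close> in the
    imaginary direction, which is \<open>Re (c * \<i>) = - Im c\<close>.\<close>
  define vy where "vy \<tau> = - 2 * Im c + ?\<psi>2 (\<tau>, z)" for \<tau>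
  define vx' where "vx' \<tau> h = dderiv ?\<psi>1 (1, 0) (\<tau>, z) * Re h + dderiv ?\<psi>1 (\<i>, 0) (\<tau>, z) * Im h" for \<tau> h
  define vy' where "vy' \<tau> h = dderiv ?\<psi>2 (1, 0) (\<tau>, z) * Re h + dderiv ?\<psi>2 (\<i>, 0) (\<tau>, z) * Im h" for \<tau> h
  define v' where "v' \<tau> h = vx \<tau> * Re h + vy \<tau> * Im h" for \<tau> h
  have mem: "(\<tau>, z) \<in> V" if "\<tau> \<in> cball a r" for \<tau> using V that by auto
  have diff: "\<psi> differentiable at (\<tau>, z)" "?\<psi>1 differentiable at (\<tau>, z)" "?\<psi>2 differentiable at (\<tau>, z)"
    if "\<tau> \<in> cball a r" for \<tau>
    using smooth_on_differentiable_at[OF smooth mem[OF that], of "[]"]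
      smooth_on_differentiable_at[OF smooth mem[OF that], of "[(1, 0)]"]
      smooth_on_differentiable_at[OF smooth mem[OF that], of "[(\<i>, 0)]"] by simp_all
  have dv: "(v has_derivative v' \<tau>) (at \<tau>)" if "\<tau> \<in> cball a r" for \<tau>
    unfolding v_def v'_def vx_def vy_def
    by (auto intro!: derivative_eq_intros has_derivative_complex_slice[OF diff(1)[OF that]] simp: algebra_simps)
  have dvx: "(vx has_derivative vx' \<tau>) (at \<tau>)" and dvy: "(vy has_derivative vy' \<tau>) (at \<tau>)"
    if "\<tau> \<in> cball a r" for \<tau>
    unfolding vx_def vx'_def vy_def vy'_def
    by (auto intro!: derivative_eq_intros has_derivative_complex_slice diff that simp: algebra_simps)
  have cont: "continuous_on (cball a r) (\<lambda>\<tau>. iter_dderiv vs \<psi> (\<tau>, z))" for vs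
    by (rule continuous_on_compose2[OF smooth_on_continuous_on[OF smooth, of vs]])
      (auto intro!: continuous_intros mem)
  have c2: "continuous_on (cball a r) (\<lambda>\<tau>. dderiv ?\<psi>1 (1, 0) (\<tau>, z))"
    "continuous_on (cball a r) (\<lambda>\<tau>. dderiv ?\<psi>2 (\<i>, 0) (\<tau>, z))"
    using cont[of "[(1, 0), (1, 0)]"] cont[of "[(\<i>, 0), (\<i>, 0)]"] by simp_all
  have cv: "continuous_on (cball a r) v" "continuous_on (cball a r) vx" "continuous_on (cball a r) vy"
    using dv dvx dvy by (auto intro!: continuous_at_imp_continuous_on has_derivative_continuous)
  have "(LINT \<tau>:cball a r|lborel. exp (- v \<tau>)) \<le> pi * r\<^sup>2 * (exp (- v a) - (4 * \<kappa>) * r\<^sup>2 / 8)"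
  proof (rule integral_disc_le_of_laplacian_le[OF r])
    fix \<tau> assume \<tau>: "\<tau> \<in> cball a r"
    show "((\<lambda>\<tau>. exp (- v \<tau>)) has_derivative
        (\<lambda>h. - vx \<tau> * exp (- v \<tau>) * Re h + - vy \<tau> * exp (- v \<tau>) * Im h)) (at \<tau>)"
      by (auto intro!: derivative_eq_intros dv[OF \<tau>] simp: v'_def algebra_simps)
    show "((\<lambda>\<tau>. - vx \<tau> * exp (- v \<tau>)) has_derivative
        (\<lambda>h. (vx \<tau> * v' \<tau> h - vx' \<tau> h) * exp (- v \<tau>))) (at \<tau>)"
      by (auto intro!: derivative_eq_intros dv[OF \<tau>] dvx[OF \<tau>] simp: algebra_simps)
    show "((\<lambda>\<tau>. - vy \<tau> * exp (- v \<tau>)) has_derivative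
        (\<lambda>h. (vy \<tau> * v' \<tau> h - vy' \<tau> h) * exp (- v \<tau>))) (at \<tau>)"
      by (auto intro!: derivative_eq_intros dv[OF \<tau>] dvy[OF \<tau>] simp: algebra_simps)
    \<comment> \<open>Twice \<open>c + d_tau \<psi>\<close> is \<open>vx - \<i> * vy\<close>, so the
      squared gradient of v is four times its squared modulus; the Laplacian of v is four times
      \<open>dd_tau \<psi>\<close>.\<close>
    have "(vx \<tau> * v' \<tau> 1 - vx' \<tau> 1) * exp (- v \<tau>) + (vy \<tau> * v' \<tau> \<i> - vy' \<tau> \<i>) * exp (- v \<tau>)
      = 4 * (exp (- v \<tau>) * ((cmod (c + d_tau \<psi> (\<tau>, z)))\<^sup>2 - dd_tau \<psi> (\<tau>, z)))"
      unfolding v'_def vx'_def vy'_def vx_def vy_def cmod_power2 d_tau_def dd_tau_def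
      by (simp add: field_simps power2_eq_square)
    also have "\<dots> \<le> - (4 * \<kappa>)" using lap[OF \<tau>] unfolding v_def[symmetric] by linarith
    finally show "(vx \<tau> * v' \<tau> 1 - vx' \<tau> 1) * exp (- v \<tau>) + (vy \<tau> * v' \<tau> \<i> - vy' \<tau> \<i>) * exp (- v \<tau>)
      \<le> - (4 * \<kappa>)" .
  next
    show "continuous_on (cball a r) (\<lambda>\<tau>. (vx \<tau> * v' \<tau> 1 - vx' \<tau> 1) * exp (- v \<tau>))"
      "continuous_on (cball a r) (\<lambda>\<tau>. (vy \<tau> * v' \<tau> \<i> - vy' \<tau> \<i>) * exp (- v \<tau>))"
      unfolding v'_def vx'_def vy'_def by (simp, intro continuous_intros cv c2)+
  qed
  then show ?thesis by (simp add: v_def algebra_simps)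
qed

section \<open>Integration over \<Omega>\<close>

lemma set_integrable_continuous_on_closure:
  fixes f :: "'a::euclidean_space \<Rightarrow> 'b::{banach, second_countable_topology}"
  assumes "open S" "bounded S" "continuous_on (closure S) f"
  shows "set_integrable lborel S f"
proof (rule set_integrable_subset)
  show "set_integrable lborel (closure S) f"
    unfolding set_integrable_def using assms by (intro borel_integrable_compact) auto
qed (use assms(1) closure_subset in auto)

lemma measure_lborel_open_pos:
  fixes S :: "'a::euclidean_space set"
  assumes "open S" "bounded S" "S \<noteq> {}"
  shows "0 < measure lborel S"
proof -
  have "S \<in> lmeasurable" using assms by (intro lmeasurable_open)
  then have "measure lebesgue S \<noteq> 0"
    using open_not_negligible[OF assms(1,3)] measure_eq_0_null_sets negligible_iff_measure0 by blast
  then show ?thesis using assms(1) by (simp add: zero_less_measure_iff measure_completion)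
qed

text \<open>Tonelli puts the integral over the disc inside, where the estimate for fixed z applies.
  The bound \<open>\<kappa>\<close> may vary with z: only its integral over \<Omega> will be
  compared with G(a).\<close>

lemma set_nn_integral_disc_twisted_exp_le:
  fixes \<psi> :: "complex \<times> (complex^'n) \<Rightarrow> real"
  assumes smooth: "smooth_on V \<psi>" and r: "0 < r" and \<Omega>: "open \<Omega>" "bounded \<Omega>"
    and V: "cball a r \<times> closure \<Omega> \<subseteq> V"
    and lap: "\<And>\<tau> z. \<tau> \<in> cball a r \<Longrightarrow> z \<in> \<Omega> \<Longrightarrow> exp (- (2 * Re (c * (\<tau> - a)) + \<psi> (\<tau>, z))) *
      ((cmod (c + d_tau \<psi> (\<tau>, z)))\<^sup>2 - dd_tau \<psi> (\<tau>, z)) \<le> - \<kappa> z"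
    and \<kappa>: "set_integrable lborel \<Omega> \<kappa>"
  shows "set_nn_integral lborel (ball a r \<times> \<Omega>)
      (\<lambda>(\<tau>, z). ennreal ((cmod (exp (- c * (\<tau> - a))))\<^sup>2 * exp (- \<psi> (\<tau>, z))))
    \<le> ennreal (pi * r\<^sup>2 * ((LINT z:\<Omega>|lborel. exp (- \<psi> (a, z))) - (LINT z:\<Omega>|lborel. \<kappa> z) * r\<^sup>2 / 2))"
proof -
  define u where "u p = exp (- (2 * Re (c * (fst p - a)) + \<psi> p))" for p
  define R where "R z = pi * r\<^sup>2 * (exp (- \<psi> (a, z)) - \<kappa> z * r\<^sup>2 / 2)" for z
  define F where "F p = ennreal (indicator (ball a r \<times> \<Omega>) p *\<^sub>R u p)" for p
  have c\<psi>: "continuous_on V \<psi>"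
    using smooth_on_continuous_on[OF smooth, of "[]"] by simp
  have sub: "\<Omega> \<subseteq> closure \<Omega>" by (rule closure_subset)
  have cu: "continuous_on (cball a r \<times> closure \<Omega>) u"
    unfolding u_def by (intro continuous_intros continuous_on_subset[OF c\<psi> V])
  have "continuous_on (ball a r \<times> \<Omega>) u"
    by (rule continuous_on_subset[OF cu]) (use sub in auto)
  then have "(\<lambda>p. indicator (ball a r \<times> \<Omega>) p *\<^sub>R u p) \<in> borel_measurable borel"
    by (intro borel_measurable_continuous_on_indicator borel_open open_Times \<Omega> open_ball)
  then have meas: "F \<in> borel_measurable (lborel \<Otimes>\<^sub>M lborel)"
    unfolding F_def lborel_prod measurable_lborel1 by measurable
  have e: "set_integrable lborel \<Omega> (\<lambda>z. exp (- \<psi> (a, z)))"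
    using r by (intro set_integrable_continuous_on_closure \<Omega> continuous_intros continuous_on_compose2[OF c\<psi>])
      (use V in auto)
  have intR: "set_integrable lborel \<Omega> R"
    unfolding R_def by (intro set_integrable_mult_right set_integral_diff(1) e set_integrable_divide set_integrable_mult_left \<kappa>)
  \<comment> \<open>Non-negativity of \<open>R z\<close> is inherited from the integral that it
    dominates. It is what allows the integral of \<open>ennreal (R z)\<close> to be rewritten as a
    Lebesgue integral.\<close>
  have inner: "0 \<le> R z \<and> (\<integral>\<^sup>+\<tau>. F (\<tau>, z) \<partial>lborel) \<le> ennreal (R z)" if z: "z \<in> \<Omega>" for z
  proof -
    let ?L = "LINT \<tau>:cball a r|lborel. u (\<tau>, z)"
    have "continuous_on (cball a r) (\<lambda>\<tau>. u (\<tau>, z))"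
      by (rule continuous_on_compose2[OF cu]) (use sub z in \<open>auto intro!: continuous_intros\<close>)
    then have int: "integrable lborel (\<lambda>\<tau>. indicator (cball a r) \<tau> *\<^sub>R u (\<tau>, z))"
      by (intro borel_integrable_compact) auto
    have L: "?L \<le> R z"
      unfolding u_def R_def fst_conv
      by (rule integral_disc_twisted_exp_le[OF smooth]) (use r V sub z lap in auto)
    have L0: "0 \<le> ?L"
      unfolding set_lebesgue_integral_def by (intro Bochner_Integration.integral_nonneg) (auto simp: u_def)
    have "(\<integral>\<^sup>+\<tau>. F (\<tau>, z) \<partial>lborel) \<le> (\<integral>\<^sup>+\<tau>. ennreal (indicator (cball a r) \<tau> *\<^sub>R u (\<tau>, z)) \<partial>lborel)"
      unfolding F_def by (intro nn_integral_mono ennreal_leI) (auto simp: u_def indicator_def)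
    also have "\<dots> = ennreal ?L"
      unfolding set_lebesgue_integral_def by (intro nn_integral_eq_integral int) (auto simp: u_def)
    also have "\<dots> \<le> ennreal (R z)" by (rule ennreal_leI[OF L])
    finally show ?thesis using L L0 by simp
  qed
  have "set_nn_integral lborel (ball a r \<times> \<Omega>)
      (\<lambda>(\<tau>, z). ennreal ((cmod (exp (- c * (\<tau> - a))))\<^sup>2 * exp (- \<psi> (\<tau>, z)))) = (\<integral>\<^sup>+p. F p \<partial>lborel)"
  proof (intro nn_integral_cong)
    fix p :: "complex \<times> (complex^'n)"
    have "(cmod (exp (- c * (\<tau> - a))))\<^sup>2 * exp (- \<psi> (\<tau>, z)) = u (\<tau>, z)" for \<tau> z
      unfolding u_def norm_exp_eq_Re exp_double[symmetric] exp_add[symmetric] by simp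
    then show "(case p of (\<tau>, z) \<Rightarrow> ennreal ((cmod (exp (- c * (\<tau> - a))))\<^sup>2 * exp (- \<psi> (\<tau>, z)))) *
        indicator (ball a r \<times> \<Omega>) p = F p"
      unfolding F_def by (cases p) (simp split: split_indicator)
  qed
  also have "\<dots> = (\<integral>\<^sup>+z. \<integral>\<^sup>+\<tau>. F (\<tau>, z) \<partial>lborel \<partial>lborel)"
    using lborel_pair.nn_integral_snd[OF meas] by (simp add: lborel_prod)
  also have "\<dots> \<le> (\<integral>\<^sup>+z. ennreal (indicator \<Omega> z *\<^sub>R R z) \<partial>lborel)"
    using inner by (intro nn_integral_mono) (auto simp: F_def indicator_def)
  also have "\<dots> = ennreal (LINT z:\<Omega>|lborel. R z)"
    unfolding set_lebesgue_integral_def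
    by (intro nn_integral_eq_integral intR[unfolded set_integrable_def] AE_I2) (use inner in \<open>auto simp: indicator_def\<close>)
  also have "(LINT z:\<Omega>|lborel. R z) =
      pi * r\<^sup>2 * ((LINT z:\<Omega>|lborel. exp (- \<psi> (a, z))) - (LINT z:\<Omega>|lborel. \<kappa> z) * r\<^sup>2 / 2)"
    unfolding R_def set_integral_mult_right
    by (subst set_integral_diff(2)) (use e \<kappa> in \<open>auto intro!: set_integrable_divide set_integrable_mult_left\<close>)
  finally show ?thesis .
qed

section \<open>Admissible radii and the proof of the theorem\<close>

text \<open>As U is bounded, so are the radii of discs about a inside U; the supremum is then a true
  upper bound for them, and in particular at least e.\<close>

lemma less_bdist:
  assumes "bounded U" "0 < r" "r < e" "ball a e \<subseteq> U"
  shows "r < bdist U a"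
proof -
  obtain B where B: "U \<subseteq> cball a B"
    using bounded_subset_ballD[OF assms(1), of a] ball_subset_cball by blast
  have "s \<le> B" if "0 < s" "ball a s \<subseteq> U" for s
    using that B ball_subset_cball_iff[of a s a B] by auto
  then have "bdd_above {s. 0 < s \<and> ball a s \<subseteq> U}" by (intro bdd_aboveI) auto
  then have "e \<le> bdist U a"
    unfolding bdist_def using assms by (intro cSup_upper) auto
  then show ?thesis using assms by simp
qed

theorem theorem3p6:
  fixes U :: "complex set" and \<Omega> :: "(complex^'n) set"
    and \<phi> :: "complex \<times> (complex^'n) \<Rightarrow> real" and g :: "complex \<Rightarrow> real"
  assumes "domain U" "bounded U" "domain \<Omega>" "bounded \<Omega>"
    and "psh (U \<times> \<Omega>) \<phi>"
    and "smooth_on_closure (U \<times> \<Omega>) \<phi>"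
    and "\<forall>\<tau>\<in>U. g \<tau> \<ge> 0"
    and "\<forall>\<tau>\<in>U. \<forall>z\<in>\<Omega>. dd_tau \<phi> (\<tau>, z) - (cmod (d_tau \<phi> (\<tau>, z)))\<^sup>2 \<ge> g \<tau>"
    and "\<forall>\<tau>. G \<tau> = g \<tau> +
           (cmod (LINT z:\<Omega>|lborel. d_tau \<phi> (\<tau>, z) * complex_of_real (exp (- \<phi> (\<tau>, z)))))\<^sup>2
           / (LINT z:\<Omega>|lborel. exp (- \<phi> (\<tau>, z)))\<^sup>2"
    and "a \<in> U" and "(\<epsilon>::real) > 0"
  shows "\<exists>r\<^sub>\<epsilon>. 0 < r\<^sub>\<epsilon> \<and> r\<^sub>\<epsilon> < bdist U a \<and>
           (\<forall>r. 0 < r \<and> r < r\<^sub>\<epsilon> \<longrightarrow>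
              (\<exists>f. f holomorphic_on ball a r \<and> f a = 1 \<and>
                 set_nn_integral lborel (ball a r \<times> \<Omega>)
                   (\<lambda>(\<tau>, z). ennreal ((cmod (f \<tau>))\<^sup>2 * exp (- \<phi> (\<tau>, z))))
                 \<le> ennreal (exp (- max ((G a - \<epsilon>) / 2) 0 * r\<^sup>2) * pi * r\<^sup>2
                      * (LINT z:\<Omega>|lborel. exp (- \<phi> (a, z))))))"
proof -
  have U: "open U" and \<Omega>: "open \<Omega>" "bounded \<Omega>" "\<Omega> \<noteq> {}"
    using assms(1,3,4) by (auto simp: domain_def)
  obtain V \<psi> where V: "closure U \<times> closure \<Omega> \<subseteq> V" and smooth: "smooth_on V \<psi>"
    and eq: "\<And>x. x \<in> U \<times> \<Omega> \<Longrightarrow> \<psi> x = \<phi> x"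
    using assms(6) by (auto simp: smooth_on_closure_def closure_Times)
  have subV: "U \<times> \<Omega> \<subseteq> V" using V closure_subset[of U] closure_subset[of \<Omega>] by blast
  note cong = iter_dderiv_cong_open[OF smooth open_Times[OF U \<Omega>(1)] subV eq]
  have eq_d: "d_tau \<phi> p = d_tau \<psi> p" "dd_tau \<phi> p = dd_tau \<psi> p" if "p \<in> U \<times> \<Omega>" for p
    using cong[OF _ that, of "[(1, 0)]"] cong[OF _ that, of "[(\<i>, 0)]"]
      cong[OF _ that, of "[(1, 0), (1, 0)]"] cong[OF _ that, of "[(\<i>, 0), (\<i>, 0)]"]
    by (simp_all add: d_tau_def dd_tau_def)
  have c\<psi>: "continuous_on V \<psi>" "continuous_on V (d_tau \<psi>)" "continuous_on V (dd_tau \<psi>)"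
    using smooth_on_continuous_on[OF smooth, of "[]"]
      smooth_on_continuous_on[OF smooth, of "[(1, 0)]"] smooth_on_continuous_on[OF smooth, of "[(\<i>, 0)]"]
      smooth_on_continuous_on[OF smooth, of "[(1, 0), (1, 0)]"]
      smooth_on_continuous_on[OF smooth, of "[(\<i>, 0), (\<i>, 0)]"]
    unfolding d_tau_def[abs_def] dd_tau_def[abs_def] by (auto intro!: continuous_intros)
  have lap: "(cmod (d_tau \<psi> (\<tau>, z)))\<^sup>2 - dd_tau \<psi> (\<tau>, z) \<le> - g \<tau>" if "\<tau> \<in> U" "z \<in> \<Omega>" for \<tau> z
    using assms(8) that eq_d[of "(\<tau>, z)"] by fastforce
  obtain e where e: "0 < e" "ball a e \<subseteq> U" using U assms(10) openE by blast
  \<comment> \<open>Halving e keeps the closed disc inside U, which gives compactness, and puts R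
    strictly below \<open>bdist U a\<close>.\<close>
  define R where "R = e / 2"
  have R: "0 < R" "cball a R \<subseteq> U" using e by (auto simp: R_def)
  have R_bdist: "s < bdist U a" if "0 < s" "s \<le> R" for s
    using less_bdist[OF assms(2) that(1) _ e(2)] that e R_def by auto
  have RV: "cball a r \<times> closure \<Omega> \<subseteq> V" if "r \<le> R" for r
    using V R(2) closure_subset[of U] subset_cball[OF that, of a] by blast
  have aV: "continuous_on (closure \<Omega>) (\<lambda>z. f (a, z))" if "continuous_on V f"
    for f :: "_ \<Rightarrow> 'z::topological_space"
    by (rule continuous_on_compose2[OF that]) (use RV[of R] R(1) in \<open>auto intro!: continuous_intros\<close>)

  define E where "E = (LINT z:\<Omega>|lborel. exp (- \<psi> (a, z)))"
  define I where "I = (LINT z:\<Omega>|lborel. d_tau \<psi> (a, z) * complex_of_real (exp (- \<psi> (a, z))))"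
  define m where "m = measure lborel \<Omega>"
  have E_eq: "(LINT z:\<Omega>|lborel. exp (- \<phi> (a, z))) = E"
    unfolding E_def using \<Omega>(1) assms(10) eq by (intro set_lebesgue_integral_cong) auto
  have I_eq: "(LINT z:\<Omega>|lborel. d_tau \<phi> (a, z) * complex_of_real (exp (- \<phi> (a, z)))) = I"
    unfolding I_def using \<Omega>(1) assms(10) eq eq_d by (intro set_lebesgue_integral_cong) auto
  have Ga: "G a = g a + (cmod I)\<^sup>2 / E\<^sup>2"
    using assms(9) by (simp add: E_eq I_eq)
  have m: "0 < m" unfolding m_def by (rule measure_lborel_open_pos[OF \<Omega>])
  have intE: "set_integrable lborel \<Omega> (\<lambda>z. exp (- \<psi> (a, z)))"
    by (intro set_integrable_continuous_on_closure \<Omega> continuous_intros aV c\<psi>)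
  have intI: "set_integrable lborel \<Omega> (\<lambda>z. d_tau \<psi> (a, z) * complex_of_real (exp (- \<psi> (a, z))))"
    by (intro set_integrable_continuous_on_closure \<Omega> continuous_intros aV c\<psi>)
  have const: "set_integrable lborel \<Omega> (\<lambda>z. k)" "(LINT z:\<Omega>|lborel. k) = k * m" for k :: real
    by (intro set_integrable_continuous_on_closure \<Omega> continuous_intros,
        simp add: m_def set_lebesgue_integral_def)
  \<comment> \<open>On the compact closure \<open>\<psi> (a, z)\<close> has a maximum, so the
    integrand is at least a positive constant on a set of positive measure.\<close>
  have E: "0 < E"
  proof -
    have "compact (closure \<Omega>)" "closure \<Omega> \<noteq> {}" using \<Omega> by auto
    then obtain z0 where z0: "\<And>z. z \<in> closure \<Omega> \<Longrightarrow> \<psi> (a, z) \<le> \<psi> (a, z0)"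
      using continuous_attains_sup[OF _ _ aV[OF c\<psi>(1)]] by blast
    have "(LINT z:\<Omega>|lborel. exp (- \<psi> (a, z0))) \<le> E"
      unfolding E_def using z0 closure_subset[of \<Omega>] by (intro set_integral_mono const intE) auto
    moreover have "0 < exp (- \<psi> (a, z0)) * m" using m by simp
    ultimately show ?thesis using const(2) by simp
  qed

  \<comment> \<open>Both cases end here: it remains to find c and \<kappa> with the pointwise bound
    on the disc and the prescribed integral. The witness is
    \<open>exp (- c * (\<tau> - a))\<close>.\<close>
  have conclude: "\<exists>f. f holomorphic_on ball a r \<and> f a = 1 \<and>
      set_nn_integral lborel (ball a r \<times> \<Omega>)
        (\<lambda>(\<tau>, z). ennreal ((cmod (f \<tau>))\<^sup>2 * exp (- \<phi> (\<tau>, z))))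
      \<le> ennreal (exp (- max ((G a - \<epsilon>) / 2) 0 * r\<^sup>2) * pi * r\<^sup>2 * E)"
    if r: "0 < r" "r \<le> R"
      and H: "\<And>\<tau> z. \<tau> \<in> cball a r \<Longrightarrow> z \<in> \<Omega> \<Longrightarrow> exp (- (2 * Re (c * (\<tau> - a)) + \<psi> (\<tau>, z))) *
        ((cmod (c + d_tau \<psi> (\<tau>, z)))\<^sup>2 - dd_tau \<psi> (\<tau>, z)) \<le> - \<kappa> z"
      and \<kappa>: "set_integrable lborel \<Omega> \<kappa>" "(LINT z:\<Omega>|lborel. \<kappa> z) = max (G a - \<epsilon>) 0 * E"
    for r c \<kappa>
  proof (intro exI conjI)
    define q where "q = max ((G a - \<epsilon>) / 2) 0"
    have ball_U: "\<tau> \<in> U" if "dist a \<tau> < r" for \<tau> using R(2) r(2) that by auto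
    have q: "max (G a - \<epsilon>) 0 = 2 * q" by (simp add: q_def max_def)
    have "set_nn_integral lborel (ball a r \<times> \<Omega>)
        (\<lambda>(\<tau>, z). ennreal ((cmod (exp (- c * (\<tau> - a))))\<^sup>2 * exp (- \<phi> (\<tau>, z))))
      = set_nn_integral lborel (ball a r \<times> \<Omega>)
        (\<lambda>(\<tau>, z). ennreal ((cmod (exp (- c * (\<tau> - a))))\<^sup>2 * exp (- \<psi> (\<tau>, z))))"
      using eq ball_U by (intro nn_integral_cong) (auto split: split_indicator)
    also have "\<dots> \<le> ennreal (pi * r\<^sup>2 * (E - max (G a - \<epsilon>) 0 * E * r\<^sup>2 / 2))"
      unfolding E_def[symmetric] \<kappa>(2)[symmetric] unfolding E_def
      by (rule set_nn_integral_disc_twisted_exp_le[OF smooth r(1) \<Omega>(1,2) RV[OF r(2)] H \<kappa>(1)])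
    also have "\<dots> = ennreal (pi * r\<^sup>2 * E * (1 + - q * r\<^sup>2))"
      by (simp add: q algebra_simps)
    also have "\<dots> \<le> ennreal (pi * r\<^sup>2 * E * exp (- q * r\<^sup>2))"
      using E by (intro ennreal_leI mult_left_mono exp_ge_add_one_self) auto
    finally show "set_nn_integral lborel (ball a r \<times> \<Omega>)
        (\<lambda>(\<tau>, z). ennreal ((cmod (exp (- c * (\<tau> - a))))\<^sup>2 * exp (- \<phi> (\<tau>, z))))
      \<le> ennreal (exp (- max ((G a - \<epsilon>) / 2) 0 * r\<^sup>2) * pi * r\<^sup>2 * E)"
      unfolding q_def by (simp add: mult_ac)
  qed (auto intro!: holomorphic_intros)

  show ?thesis
  proof (cases "G a \<le> \<epsilon>")
    case True
    show ?thesis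
      unfolding E_eq
    proof (intro exI[of _ R] conjI allI impI R_bdist R)
      fix r assume r: "0 < r \<and> r < R"
      show "\<exists>f. f holomorphic_on ball a r \<and> f a = 1 \<and>
        set_nn_integral lborel (ball a r \<times> \<Omega>)
          (\<lambda>(\<tau>, z). ennreal ((cmod (f \<tau>))\<^sup>2 * exp (- \<phi> (\<tau>, z))))
        \<le> ennreal (exp (- max ((G a - \<epsilon>) / 2) 0 * r\<^sup>2) * pi * r\<^sup>2 * E)"
      \<comment> \<open>With c = 0 the witness is constant, and the bound by 0 follows from the
        curvature hypothesis and g \<ge> 0.\<close>
      proof (rule conclude[of r 0 "\<lambda>_. 0"])
        fix \<tau> z assume "\<tau> \<in> cball a r" and z: "z \<in> \<Omega>"
        then have \<tau>: "\<tau> \<in> U" using R(2) r by auto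
        then show "exp (- (2 * Re (0 * (\<tau> - a)) + \<psi> (\<tau>, z))) *
            ((cmod (0 + d_tau \<psi> (\<tau>, z)))\<^sup>2 - dd_tau \<psi> (\<tau>, z)) \<le> - 0"
          using lap[OF \<tau> z] assms(7) by (auto simp: mult_le_0_iff)
      qed (use r True const in auto)
    qed simp
  next
    case False
    \<comment> \<open>This c minimises \<open>(cmod c)\<^sup>2 * E + 2 * Re (cnj c * I)\<close>, the
      part of the integrated bound at a that depends on c.\<close>
    define c where "c = - I / complex_of_real E"
    \<comment> \<open>An error \<eta> at every z costs \<open>\<eta> * m = \<epsilon> * E\<close>
      after integration over \<Omega>.\<close>
    define \<eta> where "\<eta> = \<epsilon> * E / m"
    define H where "H p = exp (- (2 * Re (c * (fst p - a)) + \<psi> p)) *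
      ((cmod (c + d_tau \<psi> p))\<^sup>2 - dd_tau \<psi> p)" for p
    \<comment> \<open>Expanding the square in \<open>H (a, z)\<close> and using the curvature
      hypothesis gives an upper bound; \<kappa> is its negative, lowered by \<eta> to leave room for
      moving from a to \<tau>.\<close>
    define \<kappa> where "\<kappa> z = (g a - (cmod c)\<^sup>2) * exp (- \<psi> (a, z)) -
      2 * Re (cnj c * (d_tau \<psi> (a, z) * complex_of_real (exp (- \<psi> (a, z))))) - \<eta>" for z
    have \<eta>: "0 < \<eta>" using assms(11) E m by (simp add: \<eta>_def)
    have H_a: "H (a, z) \<le> - \<kappa> z - \<eta>" if z: "z \<in> \<Omega>" for z
    proof -
      have sq: "(cmod (c + d))\<^sup>2 = (cmod c)\<^sup>2 + 2 * Re (cnj c * d) + (cmod d)\<^sup>2" for d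
        unfolding cmod_power2 by (simp add: power2_eq_square algebra_simps)
      have "(cmod (c + d_tau \<psi> (a, z)))\<^sup>2 - dd_tau \<psi> (a, z)
          \<le> (cmod c)\<^sup>2 + 2 * Re (cnj c * d_tau \<psi> (a, z)) - g a"
        using lap[OF assms(10) z] unfolding sq by linarith
      then have "H (a, z) \<le> exp (- \<psi> (a, z)) * ((cmod c)\<^sup>2 + 2 * Re (cnj c * d_tau \<psi> (a, z)) - g a)"
        unfolding H_def by (simp add: mult_left_mono)
      also have "\<dots> = - \<kappa> z - \<eta>"
        unfolding \<kappa>_def by (simp add: algebra_simps)
      finally show ?thesis .
    qed
    have int\<kappa>: "set_integrable lborel \<Omega> (\<lambda>z. Re (cnj c * (d_tau \<psi> (a, z) * complex_of_real (exp (- \<psi> (a, z))))))"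
      by (intro set_integrable_continuous_on_closure \<Omega> continuous_intros aV c\<psi>)
    have "(LINT z:\<Omega>|lborel. \<kappa> z) = (g a - (cmod c)\<^sup>2) * E - 2 *
        (LINT z:\<Omega>|lborel. Re (cnj c * (d_tau \<psi> (a, z) * complex_of_real (exp (- \<psi> (a, z)))))) - \<eta> * m"
      unfolding \<kappa>_def E_def
      by (simp only: set_integral_diff(2)[OF set_integral_diff(1)] set_integral_diff(2)
          set_integrable_mult_right intE int\<kappa> const set_integral_mult_right)
    also have "(LINT z:\<Omega>|lborel. Re (cnj c * (d_tau \<psi> (a, z) * complex_of_real (exp (- \<psi> (a, z)))))) = Re (cnj c * I)"
    proof -
      have "set_integrable lborel \<Omega> (\<lambda>z. cnj c * (d_tau \<psi> (a, z) * complex_of_real (exp (- \<psi> (a, z)))))"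
        by (intro set_integrable_mult_right intI)
      from integral_Re[OF this[unfolded set_integrable_def]] show ?thesis
        unfolding I_def set_integral_mult_right[symmetric] unfolding set_lebesgue_integral_def by simp
    qed
    \<comment> \<open>By the choice of c the cross term contributes twice
      \<open>(cmod c)\<^sup>2 * E\<close>, which turns the coefficient -1 of that quantity into +1
      and produces G(a).\<close>
    also have "cnj c * I = - complex_of_real ((cmod c)\<^sup>2 * E)"
    proof -
      have "I = - c * complex_of_real E" using E by (simp add: c_def)
      then have "cnj c * I = - (c * cnj c) * complex_of_real E" by (simp add: mult_ac)
      then show ?thesis unfolding complex_norm_square[symmetric] by simp
    qed
    also have "\<eta> * m = \<epsilon> * E" using m by (simp add: \<eta>_def)
    also have "(g a - (cmod c)\<^sup>2) * E - 2 * Re (- complex_of_real ((cmod c)\<^sup>2 * E)) - \<epsilon> * E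
        = (g a + (cmod c)\<^sup>2 - \<epsilon>) * E"
      by (simp add: algebra_simps)
    also have "(cmod c)\<^sup>2 = (cmod I)\<^sup>2 / E\<^sup>2"
      by (simp add: c_def norm_divide power_divide)
    finally have \<kappa>: "(LINT z:\<Omega>|lborel. \<kappa> z) = max (G a - \<epsilon>) 0 * E"
      using False by (simp add: Ga)
    \<comment> \<open>Compactness of the closure of \<Omega> makes the modulus of continuity, and
      hence the radius, independent of z.\<close>
    have "continuous_on (cball a R \<times> closure \<Omega>) H"
      unfolding H_def by (intro continuous_intros continuous_on_subset[OF c\<psi>(1) RV]
          continuous_on_subset[OF c\<psi>(2) RV] continuous_on_subset[OF c\<psi>(3) RV] order_refl)
    moreover have "compact (cball a R \<times> closure \<Omega>)" using \<Omega> by (intro compact_Times) auto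
    ultimately obtain d where d: "0 < d" "\<And>p q. p \<in> cball a R \<times> closure \<Omega> \<Longrightarrow>
        q \<in> cball a R \<times> closure \<Omega> \<Longrightarrow> dist q p < d \<Longrightarrow> dist (H q) (H p) < \<eta>"
      using compact_uniformly_continuous \<eta> unfolding uniformly_continuous_on_def by metis
    define r0 where "r0 = min R d"
    have r0: "0 < r0" "r0 \<le> R" "r0 \<le> d" using R d by (auto simp: r0_def)
    show ?thesis
      unfolding E_eq
    proof (intro exI[of _ r0] conjI allI impI R_bdist r0)
      fix r assume r: "0 < r \<and> r < r0"
      show "\<exists>f. f holomorphic_on ball a r \<and> f a = 1 \<and>
        set_nn_integral lborel (ball a r \<times> \<Omega>)
          (\<lambda>(\<tau>, z). ennreal ((cmod (f \<tau>))\<^sup>2 * exp (- \<phi> (\<tau>, z))))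
        \<le> ennreal (exp (- max ((G a - \<epsilon>) / 2) 0 * r\<^sup>2) * pi * r\<^sup>2 * E)"
      proof (rule conclude[of r c \<kappa>])
        fix \<tau> z assume \<tau>: "\<tau> \<in> cball a r" and z: "z \<in> \<Omega>"
        have "dist (H (\<tau>, z)) (H (a, z)) < \<eta>"
          using \<tau> z r r0 R closure_subset[of \<Omega>]
          by (intro d(2)) (auto simp: dist_Pair_Pair dist_commute)
        then have "H (\<tau>, z) \<le> - \<kappa> z" using H_a[OF z] by (simp add: dist_real_def)
        then show "exp (- (2 * Re (c * (\<tau> - a)) + \<psi> (\<tau>, z))) *
            ((cmod (c + d_tau \<psi> (\<tau>, z)))\<^sup>2 - dd_tau \<psi> (\<tau>, z)) \<le> - \<kappa> z"
          by (simp add: H_def)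
      next
        show "set_integrable lborel \<Omega> \<kappa>"
          unfolding \<kappa>_def by (intro set_integral_diff(1) set_integrable_mult_right intE int\<kappa> const)
      qed (use r r0 \<kappa> in auto)
    qed
  qed
qed

end
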